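(* Let $d\geq 2$. Then $$c_n\leq\exp\left[\sqrt{8n}+O\left(\sqrt{1/n}\right)\right]\mu_c^{n+1}$$ as $n\to\infty$; that is, there exist a constant $K<\infty$ and an integer $N\ge 1$ such that $c_n\leq\exp\left[\sqrt{8n}+K n^{-1/2}\right]\mu_c^{n+1}$ for every $n\geq N$.
   Context: A self-avoiding walk (SAW) of length $n$ on the hypercubic lattice $\mathbb{Z}^d$ is a nearest-neighbour path $(\omega_0,\ldots,\omega_n)$ in $\mathbb{Z}^d$ that does not visit any vertex more than once. $c_n$ denotes the number of length-$n$ self-avoiding walks starting at the origin, and $\mu_c=\mu_c(d)=\lim_{n\to\infty}c_n^{1/n}$ is the connective constant of $\mathbb{Z}^d$. *)

theory Defs
  imports "HOL-Analysis.Analysis"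
begin

text \<open>
  The lattice \<open>\<int>\<^sup>d\<close> is the type \<open>int ^ 'd\<close> with \<open>d = CARD('d)\<close>. A walk of length \<open>n\<close> is the list
  of its \<open>n + 1\<close> vertices.
\<close>

definition lattice_adj :: "int ^ 'd \<Rightarrow> int ^ 'd \<Rightarrow> bool" where
  "lattice_adj x y \<longleftrightarrow> (\<Sum>i\<in>UNIV. \<bar>x $ i - y $ i\<bar>) = 1"

definition is_saw :: "nat \<Rightarrow> (int ^ 'd) list \<Rightarrow> bool" where
  "is_saw n \<omega> \<longleftrightarrow>
     length \<omega> = n + 1 \<and> (\<forall>i<n. lattice_adj (\<omega> ! i) (\<omega> ! (i + 1))) \<and> distinct \<omega>"

definition saw_count :: "'d::finite itself \<Rightarrow> nat \<Rightarrow> nat" where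
  "saw_count _ n = card {\<omega> :: (int ^ 'd) list. is_saw n \<omega> \<and> \<omega> ! 0 = 0}"

definition connective_constant :: "'d::finite itself \<Rightarrow> real" where
  "connective_constant d = lim (\<lambda>n. root n (real (saw_count d n)))"

end

theory Submission
  imports Defs
begin

text \<open>
  The bound comes from the Hammersley--Welsh decomposition of walks into bridges, with the counting
  done by generating functions. Fix a coordinate direction \<open>i\<close>. A half-space walk stays strictly above
  its starting point in direction \<open>i\<close>; a bridge moreover ends at its maximal height.

  A half-space walk, cut at the last visit to its maximal height, is a bridge followed by the mirror
  image of a half-space walk of strictly smaller height. Iterating, it is coded by a sequence of
  bridges with strictly decreasing spans, so each span occurs at most once and, for \<open>z \<ge> 0\<close>, the
  generating function of half-space walks is at most
  \<open>\<Prod>\<^sub>a (1 + B\<^sub>a(z)) \<le> exp (\<Sum>\<^sub>a B\<^sub>a(z))\<close>, where \<open>B\<^sub>a\<close> counts bridges of span \<open>a\<close>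
  (\<open>half_gf_le_exp_bridges\<close>). An arbitrary walk, cut at the last visit to its lowest level, is a pair
  of half-space walks, once a unit step is added to one of them; the total length is then \<open>n + 1\<close>
  (\<open>saw_count_le_half_gf\<close>).

  Bridges can be concatenated freely, so the number \<open>b\<^sub>n\<close> of bridges satisfies
  \<open>b\<^sub>n\<^sup>k \<le> b\<^sub>n\<^sub>k \<le> c\<^sub>n\<^sub>k\<close>, hence \<open>b\<^sub>n \<le> \<mu>\<^sup>n\<close> for the connective constant \<open>\<mu>\<close>
  (\<open>card_bridges_le_connective_power\<close>). At \<open>z = 1 / (\<mu> (1 + \<delta>))\<close> the bridge series is thus dominated by a
  geometric series with sum \<open>1 / \<delta>\<close>, and so \<open>c\<^sub>n z\<^sup>n\<^sup>+\<^sup>1 \<le> exp (2 / \<delta>)\<close> (\<open>saw_count_le\<close>).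
  Since \<open>(1 + \<delta>)\<^sup>n\<^sup>+\<^sup>1 \<le> exp ((n + 1) \<delta>)\<close>, it remains to minimise \<open>2 / \<delta> + n \<delta>\<close>: the choice
  \<open>\<delta> = sqrt (2 / n)\<close> gives \<open>sqrt (8 n)\<close>, with an error \<open>\<delta> = sqrt 2 / sqrt n\<close>.

  All generating functions are truncated to finite sums, so no question of convergence arises in them.
\<close>

section \<open>Self-avoiding walks and their symmetries\<close>

definition saws :: "nat \<Rightarrow> (int ^ 'd::finite) list set" where
  "saws n = {w. is_saw n w \<and> w ! 0 = 0}"

lemma lattice_adj_commute: "lattice_adj x y = lattice_adj y x"
  by (simp add: lattice_adj_def abs_minus_commute)

lemma lattice_adj_translate [simp]:
  "lattice_adj (x + a) (y + a) = lattice_adj x y" "lattice_adj (a + x) (a + y) = lattice_adj x y"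
  "lattice_adj (x - a) (y - a) = lattice_adj x y"
  by (simp_all add: lattice_adj_def)

definition reflect :: "'d::finite \<Rightarrow> int ^ 'd \<Rightarrow> int ^ 'd" where
  "reflect i x = (\<chi> l. if l = i then - (x $ l) else x $ l)"

lemma lattice_adj_reflect [simp]: "lattice_adj (reflect i x) (reflect i y) = lattice_adj x y"
proof -
  have "\<bar>reflect i x $ l - reflect i y $ l\<bar> = \<bar>x $ l - y $ l\<bar>" for l
    by (simp add: reflect_def abs_minus_commute)
  then show ?thesis by (simp add: lattice_adj_def)
qed

lemma reflect_reflect [simp]: "reflect i (reflect i x) = x"
  by (simp add: reflect_def vec_eq_iff)

lemma reflect_nth [simp]: "reflect i x $ i = - (x $ i)"
  by (simp add: reflect_def)

lemma reflect_zero [simp]: "reflect i 0 = 0"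
  by (simp add: reflect_def vec_eq_iff)

lemma inj_reflect: "inj (reflect i)"
  by (metis reflect_reflect injI)

lemma lattice_adj_coord: "lattice_adj x y \<Longrightarrow> \<bar>x $ i - y $ i\<bar> \<le> 1"
  for x y :: "int ^ 'd::finite"
  unfolding lattice_adj_def
  by (metis (no_types, lifting) UNIV_I abs_ge_zero finite_class.finite_UNIV member_le_sum)

lemma lattice_adj_axis: "lattice_adj 0 (axis i 1 :: int ^ 'd::finite)"
proof -
  have "\<bar>0 $ l - (axis i 1 :: int ^ 'd) $ l\<bar> = (if l = i then 1 else 0)" for l
    by (simp add: axis_def)
  then show ?thesis by (simp add: lattice_adj_def)
qed

lemma is_saw_take: "is_saw n w \<Longrightarrow> k \<le> n \<Longrightarrow> is_saw k (take (Suc k) w)"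
  by (auto simp: is_saw_def)

lemma is_saw_drop: "is_saw n w \<Longrightarrow> k \<le> n \<Longrightarrow> is_saw (n - k) (drop k w)"
  by (auto simp: is_saw_def)

lemma is_saw_rev:
  assumes "is_saw n w" shows "is_saw n (rev w)"
proof -
  have "lattice_adj (rev w ! i) (rev w ! Suc i)" if "i < n" for i
  proof -
    have "lattice_adj (w ! (n - Suc i)) (w ! (n - Suc i + 1))"
      using assms that by (simp add: is_saw_def)
    moreover have "n - Suc i + 1 = n - i" using that by simp
    ultimately show ?thesis
      using assms that by (simp add: is_saw_def rev_nth lattice_adj_commute)
  qed
  then show ?thesis using assms by (simp add: is_saw_def)
qed

lemma is_saw_map:
  assumes "is_saw n w" "inj f" "\<And>x y. lattice_adj (f x) (f y) = lattice_adj x y"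
  shows "is_saw n (map f w)"
  using assms by (auto simp: is_saw_def distinct_map inj_on_def)

text \<open>
  The height changes by at most one per step.
\<close>

lemma saw_coord_bound:
  assumes "is_saw n w" "j \<le> k" "k \<le> n"
  shows "\<bar>w ! k $ i - w ! j $ i\<bar> \<le> int (k - j)"
  using assms(2,3)
proof (induction k rule: dec_induct)
  case (step k)
  have "lattice_adj (w ! k) (w ! Suc k)" using assms step by (simp add: is_saw_def)
  then have "\<bar>w ! k $ i - w ! Suc k $ i\<bar> \<le> 1" by (rule lattice_adj_coord)
  moreover have "\<bar>w ! k $ i - w ! j $ i\<bar> \<le> int (k - j)" using step by simp
  moreover have "int (Suc k - j) = int (k - j) + 1" using step by simp
  ultimately show ?case by linarith
qed simp

lemma finite_box: "finite {x :: int ^ 'd::finite. \<forall>i. \<bar>x $ i\<bar> \<le> B}"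
proof -
  have "{x :: int ^ 'd. \<forall>i. \<bar>x $ i\<bar> \<le> B} \<subseteq> vec_lambda ` (UNIV \<rightarrow>\<^sub>E {-B..B})"
  proof
    fix x :: "int ^ 'd" assume "x \<in> {x. \<forall>i. \<bar>x $ i\<bar> \<le> B}"
    then have "vec_nth x \<in> UNIV \<rightarrow>\<^sub>E {-B..B}" by (auto simp: abs_le_iff minus_le_iff)
    then show "x \<in> vec_lambda ` (UNIV \<rightarrow>\<^sub>E {-B..B})" by (metis image_eqI vec_nth_inverse)
  qed
  then show ?thesis by (rule finite_subset) (intro finite_imageI finite_PiE, auto)
qed

lemma finite_saws [simp]: "finite (saws n :: (int ^ 'd::finite) list set)"
proof -
  have "saws n \<subseteq> {w :: (int ^ 'd) list. set w \<subseteq> {x. \<forall>i. \<bar>x $ i\<bar> \<le> int n} \<and> length w = n + 1}"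
  proof
    fix w :: "(int ^ 'd) list" assume w: "w \<in> saws n"
    have "\<bar>w ! k $ i\<bar> \<le> int n" if "k \<le> n" for k i
      using saw_coord_bound[of n w 0 k i] w that by (simp add: saws_def)
    then show "w \<in> {w. set w \<subseteq> {x. \<forall>i. \<bar>x $ i\<bar> \<le> int n} \<and> length w = n + 1}"
      using w by (auto simp: saws_def is_saw_def in_set_conv_nth)
  qed
  then show ?thesis by (rule finite_subset) (rule finite_lists_length_eq[OF finite_box])
qed

lemma saws_drop:
  fixes w :: "(int ^ 'd::finite) list"
  assumes "is_saw n w" "k \<le> n" "inj g" "g 0 = 0" "\<And>x y. lattice_adj (g x) (g y) = lattice_adj x y"
  shows "map (\<lambda>x. g (x - w ! k)) (drop k w) \<in> saws (n - k)"
proof -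
  have "is_saw (n - k) (map (\<lambda>x. g (x - w ! k)) (drop k w))"
    by (intro is_saw_map is_saw_drop assms) (simp_all add: inj_def inj_eq[OF assms(3)] assms(5))
  then show ?thesis using assms by (simp add: saws_def is_saw_def)
qed

lemma saws_take: "w \<in> saws n \<Longrightarrow> k \<le> n \<Longrightarrow> take (Suc k) w \<in> saws k"
  by (auto simp: saws_def intro: is_saw_take)

lemma saws_length: "w \<in> saws n \<Longrightarrow> length w = Suc n"
  by (simp add: saws_def is_saw_def)

text \<open>
  The first vertex of \<open>v\<close> is dropped because it is glued onto the last vertex of \<open>u\<close>. Taking for \<open>f\<close> the
  identity concatenates walks; taking a reflection turns the second walk upside down.
\<close>

definition concat_walk :: "(int ^ 'd \<Rightarrow> int ^ 'd) \<Rightarrow> (int ^ 'd) list \<Rightarrow> (int ^ 'd) list \<Rightarrow> (int ^ 'd::finite) list" where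
  "concat_walk f u v = u @ map (\<lambda>x. last u + f x) (tl v)"

lemma concat_walk_split:
  assumes "length w = Suc n" "k \<le> n" "\<And>x. f (g x) = x"
  shows "w = concat_walk f (take (Suc k) w) (map (\<lambda>x. g (x - w ! k)) (drop k w))"
proof -
  have "last (take (Suc k) w) = w ! k"
    using assms by (simp add: take_Suc_conv_app_nth)
  then show ?thesis
    using assms by (simp add: concat_walk_def map_tl[symmetric] comp_def drop_Suc[symmetric] tl_drop)
qed

section \<open>Half-space walks and bridges\<close>

text \<open>
  The first \<open>nat\<close> argument bounds the height, since the decomposition into bridges is an induction on it;
  at \<open>A = n\<close> the upper bound is automatic.
\<close>

definition half_space_saws :: "'d::finite \<Rightarrow> nat \<Rightarrow> nat \<Rightarrow> (int ^ 'd) list set" where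
  "half_space_saws i A n = {w \<in> saws n. \<forall>j. 1 \<le> j \<and> j \<le> n \<longrightarrow> 0 < w ! j $ i \<and> w ! j $ i \<le> int A}"

definition bridges :: "'d::finite \<Rightarrow> nat \<Rightarrow> (int ^ 'd) list set" where
  "bridges i n = {w \<in> saws n. \<forall>j. 1 \<le> j \<and> j \<le> n \<longrightarrow> 0 < w ! j $ i \<and> w ! j $ i \<le> w ! n $ i}"

definition span_bridges :: "'d::finite \<Rightarrow> nat \<Rightarrow> nat \<Rightarrow> (int ^ 'd) list set" where
  "span_bridges i A n = {w \<in> bridges i n. w ! n $ i = int A}"

lemma finite_half_space_saws [simp]: "finite (half_space_saws i A n)"
  by (rule finite_subset[OF _ finite_saws[of n]]) (auto simp: half_space_saws_def)

lemma finite_bridges [simp]: "finite (bridges i n)"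
  by (rule finite_subset[OF _ finite_saws[of n]]) (auto simp: bridges_def)

lemma finite_span_bridges [simp]: "finite (span_bridges i A n)"
  by (rule finite_subset[OF _ finite_bridges[of i n]]) (auto simp: span_bridges_def)

section \<open>Bridges and the connective constant\<close>

text \<open>
  A walk of length \<open>m + n\<close> is recovered from its first \<open>m\<close> steps and its last \<open>n\<close> steps.
\<close>

lemma card_saws_submult:
  "card (saws (m + n) :: (int ^ 'd::finite) list set)
    \<le> card (saws m :: (int ^ 'd) list set) * card (saws n :: (int ^ 'd) list set)"
proof -
  have "saws (m + n) \<subseteq> (\<lambda>(u, v). concat_walk (\<lambda>x. x) u v) ` (saws m \<times> (saws n :: (int ^ 'd) list set))"
  proof
    fix w :: "(int ^ 'd) list" assume w: "w \<in> saws (m + n)"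
    have "map (\<lambda>x. x - w ! m) (drop m w) \<in> saws n"
      using saws_drop[of "m + n" w m "\<lambda>x. x"] w by (simp add: saws_def)
    moreover have "take (Suc m) w \<in> saws m" using w by (auto intro: saws_take)
    moreover have "w = concat_walk (\<lambda>x. x) (take (Suc m) w) (map (\<lambda>x. x - w ! m) (drop m w))"
      using w by (intro concat_walk_split) (auto dest: saws_length)
    ultimately show "w \<in> (\<lambda>(u, v). concat_walk (\<lambda>x. x) u v) ` (saws m \<times> saws n)"
      by (intro image_eqI[where x = "(take (Suc m) w, map (\<lambda>x. x - w ! m) (drop m w))"]) auto
  qed
  then have "card (saws (m + n) :: (int ^ 'd) list set) \<le> card ((saws m :: (int ^ 'd) list set) \<times> (saws n :: (int ^ 'd) list set))"
    by (rule surj_card_le[rotated]) simp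
  then show ?thesis by (simp add: card_cartesian_product)
qed

lemma concat_walk_nth:
  assumes "u \<in> saws m" "v \<in> saws n"
  shows "length (concat_walk (\<lambda>x. x) u v) = Suc (m + n)"
    and "j \<le> m \<Longrightarrow> concat_walk (\<lambda>x. x) u v ! j = u ! j"
    and "j \<le> n \<Longrightarrow> concat_walk (\<lambda>x. x) u v ! (m + j) = u ! m + v ! j"
proof -
  have len: "length u = Suc m" "length v = Suc n" "v ! 0 = 0"
    using assms saws_length by (auto simp: saws_def)
  then have "u \<noteq> []" by auto
  have l: "last u = u ! m" using len \<open>u \<noteq> []\<close> by (simp add: last_conv_nth)
  show "length (concat_walk (\<lambda>x. x) u v) = Suc (m + n)"
    using len by (simp add: concat_walk_def)
  show "j \<le> m \<Longrightarrow> concat_walk (\<lambda>x. x) u v ! j = u ! j"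
    using len by (simp add: concat_walk_def nth_append)
  show "j \<le> n \<Longrightarrow> concat_walk (\<lambda>x. x) u v ! (m + j) = u ! m + v ! j"
    using len l by (cases j) (simp_all add: concat_walk_def nth_append nth_tl)
qed

text \<open>
  The first bridge stays at or below the level of its endpoint, while the second one, moved to that
  endpoint, stays strictly above it; so the two cannot meet.
\<close>

lemma bridges_concat:
  assumes u: "u \<in> bridges i m" and v: "v \<in> bridges i n"
  shows "concat_walk (\<lambda>x. x) u v \<in> bridges i (m + n)"
proof -
  let ?w = "concat_walk (\<lambda>x. x) u v"
  have us: "u \<in> saws m" and vs: "v \<in> saws n" using u v by (auto simp: bridges_def)
  note nth = concat_walk_nth[OF us vs]
  have v0: "v ! 0 = 0" and u0: "u ! 0 = 0" using vs us by (auto simp: saws_def)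
  have ub: "u ! j $ i \<le> u ! m $ i" if "j \<le> m" for j
  proof (cases "j = 0")
    case True
    then show ?thesis using u u0 by (cases "m = 0") (auto simp: bridges_def intro: less_imp_le)
  qed (use u that in \<open>auto simp: bridges_def\<close>)
  have vb: "0 < v ! j $ i" "v ! j $ i \<le> v ! n $ i" if "1 \<le> j" "j \<le> n" for j
    using v that by (auto simp: bridges_def)
  have vn: "0 \<le> v ! n $ i" using vb[of n] v0 by (cases "n = 0") auto
  have adj: "lattice_adj (?w ! j) (?w ! Suc j)" if "j < m + n" for j
  proof (cases "j < m")
    case True
    then show ?thesis using us nth(2)[of j] nth(2)[of "Suc j"] by (auto simp: saws_def is_saw_def)
  next
    case False
    then obtain l where "j = m + l" using le_Suc_ex[of m j] by auto
    with that have l: "j = m + l" "l < n" by auto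
    then show ?thesis using vs nth(3)[of l] nth(3)[of "Suc l"] by (auto simp: saws_def is_saw_def)
  qed
  have "distinct ?w"
    unfolding concat_walk_def distinct_append
  proof (intro conjI)
    show "distinct u" using us by (simp add: saws_def is_saw_def)
    show "distinct (map (\<lambda>x. last u + x) (tl v))"
      using vs by (auto simp: saws_def is_saw_def distinct_map inj_on_def intro: distinct_tl)
    have "x $ i \<le> u ! m $ i" if "x \<in> set u" for x
      using that ub saws_length[OF us] by (auto simp: in_set_conv_nth)
    moreover have "u ! m $ i < (last u + x) $ i" if x: "x \<in> set (tl v)" for x
    proof -
      obtain l where "l < n" "x = v ! Suc l"
        using x saws_length[OF vs] by (auto simp: in_set_conv_nth nth_tl)
      moreover have "last u = u ! m" using saws_length[OF us] by (metis diff_Suc_1 last_conv_nth list.size(3) nat.distinct(1))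
      ultimately show ?thesis using vb(1)[of "Suc l"] by simp
    qed
    ultimately show "set u \<inter> set (map (\<lambda>x. last u + x) (tl v)) = {}" by fastforce
  qed
  then have "?w \<in> saws (m + n)"
    using adj nth(1) nth(2)[of 0] u0 by (simp add: saws_def is_saw_def)
  moreover have "0 < ?w ! j $ i \<and> ?w ! j $ i \<le> ?w ! (m + n) $ i" if j: "1 \<le> j" "j \<le> m + n" for j
  proof (cases "j \<le> m")
    case True
    then have "0 < u ! j $ i" using u j by (auto simp: bridges_def)
    then show ?thesis using True ub[of j] vn nth(2)[of j] nth(3)[of n] by simp
  next
    case False
    then obtain l where "j = m + l" using le_Suc_ex[of m j] by auto
    with False j have l: "j = m + l" "l \<le> n" "1 \<le> l" by auto
    then show ?thesis using vb[of l] ub[of 0] u0 nth(3)[of l] nth(3)[of n] by simp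
  qed
  ultimately show ?thesis by (auto simp: bridges_def)
qed

text \<open>
  Here gluing has to be injective, which it is because the length \<open>m\<close> of the first piece is prescribed.
\<close>

lemma card_bridges_mult:
  "card (bridges i m) * card (bridges i n) \<le> card (bridges i (m + n))"
proof -
  have "inj_on (\<lambda>(u, v). concat_walk (\<lambda>x. x) u v) (bridges i m \<times> bridges i n)"
  proof (rule inj_onI, clarify)
    fix u v u' v'
    assume mem: "u \<in> bridges i m" "v \<in> bridges i n" "u' \<in> bridges i m" "v' \<in> bridges i n"
      and eq: "concat_walk (\<lambda>x. x) u v = concat_walk (\<lambda>x. x) u' v'"
    have s: "u \<in> saws m" "v \<in> saws n" "u' \<in> saws m" "v' \<in> saws n"
      using mem by (auto simp: bridges_def)
    note nth = concat_walk_nth[OF s(1,2)] and nth' = concat_walk_nth[OF s(3,4)]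
    have uu: "u ! j = u' ! j" if "j \<le> m" for j
      using nth(2)[OF that] nth'(2)[OF that] eq by simp
    have "v ! j = v' ! j" if "j \<le> n" for j
      using nth(3)[OF that] nth'(3)[OF that] eq uu[of m] by simp
    with uu show "u = u' \<and> v = v'"
      using s[THEN saws_length] by (auto intro!: nth_equalityI simp: less_Suc_eq_le)
  qed
  then have "card (bridges i m \<times> bridges i n) \<le> card (bridges i (m + n))"
    by (rule card_inj_on_le) (auto intro: bridges_concat)
  then show ?thesis by (simp add: card_cartesian_product)
qed

lemma card_bridges_power: "card (bridges i n) ^ k \<le> card (bridges i (n * k))"
proof (induction k)
  case 0
  have "[0] \<in> bridges i 0" by (simp add: bridges_def saws_def is_saw_def)
  then have "0 < card (bridges i 0)" unfolding card_gt_0_iff by auto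
  then show ?case by simp
next
  case (Suc k)
  have "card (bridges i n) ^ Suc k \<le> card (bridges i n) * card (bridges i (n * k))"
    using Suc by simp
  also have "\<dots> \<le> card (bridges i (n + n * k))" by (rule card_bridges_mult)
  finally show ?case by simp
qed

text \<open>
  A single upward step is a bridge, and so are its concatenation powers.
\<close>

lemma card_bridges_pos: "1 \<le> card (bridges i n)"
proof -
  have "[0, axis i 1] \<in> bridges i 1"
    using lattice_adj_axis[of i]
    by (auto simp: bridges_def saws_def is_saw_def le_Suc_eq axis_def vec_eq_iff)
  then have "1 \<le> card (bridges i 1)" by (simp add: Suc_le_eq card_gt_0_iff) blast
  then have "1 \<le> card (bridges i 1) ^ n" by (rule one_le_power)
  also have "\<dots> \<le> card (bridges i n)" using card_bridges_power[of i 1 n] by simp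
  finally show ?thesis .
qed

lemma card_bridges_le_saws: "card (bridges i n) \<le> card (saws n :: (int ^ 'd) list set)" for i :: "'d::finite"
  by (rule card_mono) (auto simp: bridges_def)

text \<open>
  Fekete's lemma. Division with remainder by a fixed \<open>m\<close> gives \<open>a n \<le> (n div m) a m + O(1)\<close>, so
  the upper limit of \<open>a n / n\<close> is at most every single ratio \<open>a m / m\<close>. Nonnegativity keeps the infimum
  finite.
\<close>

lemma fekete_subadditive:
  fixes a :: "nat \<Rightarrow> real"
  assumes sub: "\<And>m n. a (m + n) \<le> a m + a n" and nonneg: "\<And>n. 0 \<le> a n"
  shows "(\<lambda>n. a n / real n) \<longlonglongrightarrow> (INF n\<in>{1..}. a n / real n)"
proof (rule LIMSEQ_I)
  fix r :: real assume r: "0 < r"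
  define L where "L = (INF n\<in>{1..}. a n / real n)"
  have bdd: "bdd_below ((\<lambda>n. a n / real n) ` {1..})"
    using nonneg by (intro bdd_belowI[of _ 0]) auto
  have L: "L \<le> a n / real n" if "n \<ge> 1" for n
    unfolding L_def using that by (intro cINF_lower bdd) auto
  obtain m where m: "m \<ge> 1" "a m / real m < L + r / 2"
    using cINF_less_iff[OF _ bdd, of "L + r / 2"] r unfolding L_def by auto
  have mult: "a (q * m + s) \<le> real q * a m + a s" for q s
  proof (induction q)
    case (Suc q)
    have "a (Suc q * m + s) \<le> a m + a (q * m + s)" using sub[of m "q * m + s"] by (simp add: add.assoc)
    then show ?case using Suc by (simp add: algebra_simps)
  qed simp
  define M where "M = Max (a ` {..<m})"
  have M: "a s \<le> M" if "s < m" for s unfolding M_def using that by (intro Max_ge) auto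
  have M0: "0 \<le> M" using M[of 0] nonneg[of 0] m by simp
  obtain N where N: "real N > 2 * M / r" using reals_Archimedean2 by blast
  show "\<exists>no. \<forall>n\<ge>no. norm (a n / real n - (INF n\<in>{1..}. a n / real n)) < r"
  proof (intro exI allI impI)
    fix n assume n: "n \<ge> Suc N"
    have "a n \<le> real (n div m) * a m + a (n mod m)"
      using mult[of "n div m" "n mod m"] by simp
    also have "\<dots> \<le> (real n / real m) * a m + M"
      using m by (intro add_mono mult_right_mono nonneg M of_nat_div_le_of_nat) auto
    finally have "a n / real n \<le> ((real n / real m) * a m + M) / real n"
      using n by (intro divide_right_mono) auto
    also have "\<dots> = a m / real m + M / real n"
      using n by (simp add: field_simps)
    also have "M / real n < r / 2"
    proof -
      have "2 * M / r < real n" using N n by linarith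
      then show ?thesis using r n by (simp add: field_simps)
    qed
    finally have "a n / real n < L + r" using m by linarith
    moreover have "L \<le> a n / real n" using L n by simp
    ultimately show "norm (a n / real n - (INF n\<in>{1..}. a n / real n)) < r"
      unfolding L_def[symmetric] by simp
  qed
qed

lemma convergent_root_submultiplicative:
  fixes c :: "nat \<Rightarrow> real"
  assumes sub: "\<And>m n. c (m + n) \<le> c m * c n" and one: "\<And>n. 1 \<le> c n"
  shows "convergent (\<lambda>n. root n (c n))"
proof -
  have pos: "0 < c n" for n using one[of n] by linarith
  have "ln (c (m + n)) \<le> ln (c m) + ln (c n)" for m n
    using sub[of m n] pos by (metis ln_le_cancel_iff ln_mult_pos mult_pos_pos)
  then have "(\<lambda>n. ln (c n) / real n) \<longlonglongrightarrow> (INF n\<in>{1..}. ln (c n) / real n)"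
    using one by (intro fekete_subadditive) (auto intro: ln_ge_zero)
  then have "(\<lambda>n. exp (ln (c n) / real n)) \<longlonglongrightarrow> exp (INF n\<in>{1..}. ln (c n) / real n)"
    by (rule tendsto_exp)
  moreover have "\<forall>\<^sub>F n in sequentially. exp (ln (c n) / real n) = root n (c n)"
    using eventually_gt_at_top[of 0]
  proof eventually_elim
    case (elim n)
    have "root n (c n) = c n powr (1 / real n)"
      using elim pos[of n] by (simp add: root_powr_inverse less_imp_le)
    also have "\<dots> = exp (ln (c n) / real n)" using pos[of n] by (simp add: powr_def)
    finally show ?case by simp
  qed
  ultimately have "(\<lambda>n. root n (c n)) \<longlonglongrightarrow> exp (INF n\<in>{1..}. ln (c n) / real n)"
    by (rule Lim_transform_eventually)
  then show ?thesis by (rule convergentI)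
qed

lemma saw_count_eq: "saw_count TYPE('d::finite) n = card (saws n :: (int ^ 'd) list set)"
  by (simp add: saw_count_def saws_def)

text \<open>
  The connective constant is defined by \<open>lim\<close>, which carries information only once convergence is known.
\<close>

lemma connective_constant_limit:
  "(\<lambda>n. root n (real (saw_count TYPE('d::finite) n))) \<longlonglongrightarrow> connective_constant TYPE('d)"
proof -
  have "convergent (\<lambda>n. root n (real (saw_count TYPE('d) n)))"
  proof (rule convergent_root_submultiplicative)
    show "real (saw_count TYPE('d) (m + n)) \<le> real (saw_count TYPE('d) m) * real (saw_count TYPE('d) n)" for m n
      using card_saws_submult[where 'd = 'd] unfolding saw_count_eq by (metis of_nat_le_iff of_nat_mult)
    show "1 \<le> real (saw_count TYPE('d) n)" for n
      using le_trans[OF card_bridges_pos card_bridges_le_saws, of n] unfolding saw_count_eq by simp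
  qed
  then show ?thesis by (simp add: convergent_LIMSEQ_iff connective_constant_def)
qed

text \<open>
  From \<open>b\<^sub>n\<^sup>k \<le> c\<^sub>n\<^sub>k\<close> the \<open>n\<close>-th root of \<open>b\<^sub>n\<close> is at most the root of order \<open>n k\<close> of \<open>c\<^sub>n\<^sub>k\<close>; now let \<open>k\<close>
  tend to infinity.
\<close>

lemma card_bridges_le_connective_power:
  fixes i :: "'d::finite"
  assumes "n \<ge> 1"
  shows "real (card (bridges i n)) \<le> connective_constant TYPE('d) ^ n"
proof -
  let ?b = "real (card (bridges i n))"
  have "(\<lambda>k. root (n * Suc k) (real (saw_count TYPE('d) (n * Suc k)))) \<longlonglongrightarrow> connective_constant TYPE('d)"
    using LIMSEQ_subseq_LIMSEQ[OF connective_constant_limit, of "\<lambda>k. n * Suc k"] assms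
    by (simp add: comp_def strict_mono_def)
  moreover have "root n ?b \<le> root (n * Suc k) (real (saw_count TYPE('d) (n * Suc k)))" for k
  proof -
    have "card (bridges i n) ^ Suc k \<le> saw_count TYPE('d) (n * Suc k)"
      unfolding saw_count_eq by (rule le_trans[OF card_bridges_power card_bridges_le_saws])
    then have "?b ^ Suc k \<le> real (saw_count TYPE('d) (n * Suc k))"
      by (metis of_nat_le_iff of_nat_power)
    then have "root (n * Suc k) (?b ^ Suc k) \<le> root (n * Suc k) (real (saw_count TYPE('d) (n * Suc k)))"
      using assms by (intro real_root_le_mono) auto
    moreover have "root (n * Suc k) (?b ^ Suc k) = root n ?b"
      using real_root_power_cancel[of "Suc k" ?b] by (simp only: real_root_mult_exp)
    ultimately show ?thesis by simp
  qed
  ultimately have "root n ?b \<le> connective_constant TYPE('d)"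
    by (intro LIMSEQ_le_const) auto
  then have "root n ?b ^ n \<le> connective_constant TYPE('d) ^ n"
    by (intro power_mono real_root_ge_zero) simp_all
  then show ?thesis using assms by (simp add: real_root_pow_pos2)
qed

lemma connective_constant_pos: "0 < connective_constant TYPE('d::finite)"
  using card_bridges_le_connective_power[of 1 "undefined :: 'd"] card_bridges_pos[of "undefined :: 'd" 1] by simp

section \<open>Decomposing walks into bridges\<close>

text \<open>
  Walks are bounded in number by their decompositions as soon as gluing the pieces recovers every walk.
\<close>

lemma card_le_sum_products:
  assumes "S \<subseteq> T \<union> (\<Union>k\<in>K. f k ` (U k \<times> V k))" "finite T" "finite K"
    "\<And>k. finite (U k)" "\<And>k. finite (V k)"
  shows "card S \<le> card T + (\<Sum>k\<in>K. card (U k) * card (V k))"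
proof -
  have "card S \<le> card (T \<union> (\<Union>k\<in>K. f k ` (U k \<times> V k)))"
    using assms by (intro card_mono) auto
  also have "\<dots> \<le> card T + card (\<Union>k\<in>K. f k ` (U k \<times> V k))" by (rule card_Un_le)
  also have "card (\<Union>k\<in>K. f k ` (U k \<times> V k)) \<le> (\<Sum>k\<in>K. card (f k ` (U k \<times> V k)))"
    by (rule card_UN_le[OF assms(3)])
  also have "\<dots> \<le> (\<Sum>k\<in>K. card (U k) * card (V k))"
    by (rule sum_mono) (metis assms(4,5) card_cartesian_product card_image_le finite_cartesian_product)
  finally show ?thesis by simp
qed

text \<open>
  Each bridge has exactly one span, and a bridge of positive span has positive length; the second
  point is what removes the constant term from the exponent of the final bound.
\<close>

lemma sum_span_bridges:
  "(\<Sum>a\<in>{1..A}. card (span_bridges i a n)) \<le> (if n = 0 then 0 else card (bridges i n))"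
proof (cases "n = 0")
  case True
  have "span_bridges i a 0 = {}" if "a \<ge> 1" for a
    using that by (auto simp: span_bridges_def bridges_def saws_def)
  then show ?thesis using True by simp
next
  case False
  have "(\<Sum>a\<in>{1..A}. card (span_bridges i a n)) = card (\<Union>a\<in>{1..A}. span_bridges i a n)"
    by (intro card_UN_disjoint[symmetric]) (auto simp: span_bridges_def)
  also have "\<dots> \<le> card (bridges i n)"
    by (intro card_mono) (auto simp: span_bridges_def)
  finally show ?thesis using False by simp
qed

text \<open>
  If the height \<open>A + 1\<close> is attained, cut at the last time \<open>k\<close> at which it is. The first part is a bridge
  of span \<open>A + 1\<close>. The second part stays strictly below level \<open>A + 1\<close> and strictly above level \<open>0\<close>, so
  upside down it is a half-space walk of height at most \<open>A\<close>.
\<close>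

lemma card_half_space_saws_step:
  "card (half_space_saws i (Suc A) n) \<le> card (half_space_saws i A n) +
     (\<Sum>k\<le>n. card (span_bridges i (Suc A) k) * card (half_space_saws i A (n - k)))"
proof (rule card_le_sum_products[where f = "\<lambda>k (u, v). concat_walk (reflect i) u v"])
  show "half_space_saws i (Suc A) n \<subseteq> half_space_saws i A n \<union>
    (\<Union>k\<le>n. (\<lambda>(u, v). concat_walk (reflect i) u v) ` (span_bridges i (Suc A) k \<times> half_space_saws i A (n - k)))"
  proof
    fix w assume w: "w \<in> half_space_saws i (Suc A) n"
    show "w \<in> half_space_saws i A n \<union>
      (\<Union>k\<le>n. (\<lambda>(u, v). concat_walk (reflect i) u v) ` (span_bridges i (Suc A) k \<times> half_space_saws i A (n - k)))"
    proof (cases "w \<in> half_space_saws i A n")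
      case False
      define P where "P k \<longleftrightarrow> k \<le> n \<and> w ! k $ i = int (Suc A)" for k
      obtain j where "1 \<le> j" "j \<le> n" "\<not> w ! j $ i \<le> int A"
        using False w by (auto simp: half_space_saws_def)
      moreover then have "w ! j $ i \<le> int (Suc A)" using w by (auto simp: half_space_saws_def)
      ultimately have "P j" by (auto simp: P_def)
      define k where "k = (GREATEST k. P k)"
      have "P k" unfolding k_def by (rule GreatestI_nat[of P j n]) (use \<open>P j\<close> in \<open>auto simp: P_def\<close>)
      then have k: "k \<le> n" "w ! k $ i = int (Suc A)" by (auto simp: P_def)
      have klast: "l \<le> k" if "P l" for l
        unfolding k_def by (rule Greatest_le_nat[of P l n]) (use that in \<open>auto simp: P_def\<close>)
      have saw: "w \<in> saws n" and len: "length w = Suc n" using w saws_length by (auto simp: half_space_saws_def)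
      have bd: "0 < w ! l $ i \<and> w ! l $ i \<le> int (Suc A)" if "1 \<le> l" "l \<le> n" for l
        using w that by (auto simp: half_space_saws_def)
      let ?u = "take (Suc k) w" and ?v = "map (\<lambda>x. reflect i (x - w ! k)) (drop k w)"
      have u: "?u \<in> span_bridges i (Suc A) k"
        using saws_take[OF saw k(1)] bd k len by (auto simp: span_bridges_def bridges_def)
      have v: "?v \<in> half_space_saws i A (n - k)"
      proof -
        have "?v \<in> saws (n - k)"
          using saw k by (intro saws_drop inj_reflect) (auto simp: saws_def)
        moreover have "0 < w ! k $ i - w ! (k + l) $ i" "w ! k $ i - w ! (k + l) $ i \<le> int A"
          if "1 \<le> l" "l \<le> n - k" for l
          using bd[of "k + l"] klast[of "k + l"] that k unfolding P_def by linarith+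
        ultimately show ?thesis using len by (auto simp: half_space_saws_def)
      qed
      have "w = concat_walk (reflect i) ?u ?v"
        using k len by (intro concat_walk_split) auto
      then have "w = (case (?u, ?v) of (u, v) \<Rightarrow> concat_walk (reflect i) u v)"
        by (simp only: prod.case)
      then have "w \<in> (\<lambda>(u, v). concat_walk (reflect i) u v) ` (span_bridges i (Suc A) k \<times> half_space_saws i A (n - k))"
        by (rule image_eqI) (rule SigmaI[OF u v])
      then show ?thesis using k(1) by blast
    qed simp
  qed
qed auto

lemma card_half_space_saws_0: "card (half_space_saws i 0 n) \<le> (if n = 0 then 1 else 0)"
proof (cases n)
  case 0
  have "half_space_saws i 0 0 \<subseteq> {[0]}"
    by (auto simp: half_space_saws_def saws_def is_saw_def length_Suc_conv)
  then show ?thesis using 0 card_mono[of "{[0]}" "half_space_saws i 0 0"] by simp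
next
  case (Suc m)
  have "half_space_saws i 0 n = {}" using Suc by (force simp: half_space_saws_def)
  then show ?thesis by simp
qed

text \<open>
  Cut \<open>w\<close> at the last time \<open>m\<close> at which it is at its lowest level. What follows stays strictly above
  that level. What precedes may return to it, so the reversed initial part is lifted by one unit and
  preceded by one upward step: this makes it a half-space walk at the cost of one extra step, which
  is the source of the exponent \<open>n + 1\<close> in the final bound. The last line undoes the construction; the
  outer translation puts the starting point back at the origin.
\<close>

lemma split_at_min:
  fixes w :: "(int ^ 'd::finite) list"
  assumes w: "w \<in> saws n"
  shows "\<exists>m\<le>n. \<exists>u \<in> half_space_saws i (Suc n) (Suc m). \<exists>v \<in> half_space_saws i (Suc n) (n - m).
    w = (let L = rev (map (\<lambda>x. x - axis i 1) (tl u)) @ tl v in map (\<lambda>x. x - hd L) L)"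
proof -
  define a where "a = Min ((\<lambda>j. w ! j $ i) ` {..n})"
  have amin: "a \<le> w ! j $ i" if "j \<le> n" for j
    unfolding a_def using that by (intro Min_le) auto
  have "a \<in> (\<lambda>j. w ! j $ i) ` {..n}" unfolding a_def by (intro Min_in) auto
  then obtain j where j: "j \<le> n" "w ! j $ i = a" by auto
  define m where "m = (GREATEST j. j \<le> n \<and> w ! j $ i = a)"
  have m: "m \<le> n \<and> w ! m $ i = a" unfolding m_def
    by (rule GreatestI_nat[of "\<lambda>j. j \<le> n \<and> w ! j $ i = a" j n]) (use j in auto)
  have mlast: "l \<le> m" if "l \<le> n" "w ! l $ i = a" for l
    unfolding m_def by (rule Greatest_le_nat[of "\<lambda>j. j \<le> n \<and> w ! j $ i = a" l n]) (use that in auto)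
  have saw: "is_saw n w" and w0: "w ! 0 = 0" and len: "length w = Suc n"
    using w by (auto simp: saws_def is_saw_def)
  define e :: "int ^ 'd" where "e = axis i 1"
  have e: "e $ i = 1" by (simp add: e_def axis_def)
  define t where "t = map (\<lambda>x. x - w ! m + e) (rev (take (Suc m) w))"
  define u where "u = 0 # t"
  define v where "v = map (\<lambda>x. x - w ! m) (drop m w)"
  have "is_saw m t"
    unfolding t_def by (intro is_saw_map is_saw_rev is_saw_take[OF saw])
      (use m in \<open>auto simp: inj_def\<close>)
  have ul: "length t = Suc m" using len m by (simp add: t_def)
  have un: "u ! Suc l = w ! (m - l) - w ! m + e" if "l \<le> m" for l
    using that len m by (simp add: u_def t_def rev_nth)
  have ub: "0 < u ! l $ i" "u ! l $ i \<le> int (Suc n)" if l: "1 \<le> l" "l \<le> Suc m" for l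
  proof -
    obtain l' where l': "l = Suc l'" "l' \<le> m" using l by (cases l) auto
    have "a \<le> w ! (m - l') $ i" using m by (intro amin) linarith
    then show "0 < u ! l $ i" "u ! l $ i \<le> int (Suc n)"
      using saw_coord_bound[OF saw, of "m - l'" m i] m l' un[of l'] e by auto
  qed
  have "u \<in> half_space_saws i (Suc n) (Suc m)"
  proof -
    have "is_saw (Suc m) u"
      unfolding is_saw_def
    proof (intro conjI allI impI)
      show "length u = Suc m + 1" using ul by (simp add: u_def)
      show "lattice_adj (u ! l) (u ! (l + 1))" if "l < Suc m" for l
      proof (cases l)
        case 0
        then show ?thesis using un[of 0] lattice_adj_axis[of i] by (simp add: u_def e_def)
      next
        case (Suc l')
        then show ?thesis using that
          \<open>is_saw m t\<close>
          by (simp add: is_saw_def u_def)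
      qed
      have "0 \<notin> set t"
      proof
        assume "0 \<in> set t"
        then obtain l where "l \<le> m" "u ! Suc l = 0"
          using ul unfolding u_def by (metis in_set_conv_nth less_Suc_eq_le nth_Cons_Suc)
        then show False using ub(1)[of "Suc l"] by simp
      qed
      then show "distinct u"
        using \<open>is_saw m t\<close>
        by (simp add: is_saw_def u_def)
    qed
    then show ?thesis using ub by (simp add: half_space_saws_def saws_def) (simp add: u_def)
  qed
  moreover have "v \<in> half_space_saws i (Suc n) (n - m)"
  proof -
    have "v \<in> saws (n - m)"
      using saws_drop[OF saw, of m "\<lambda>x. x"] m by (simp add: v_def)
    moreover have "0 < v ! l $ i" "v ! l $ i \<le> int (Suc n)" if l: "1 \<le> l" "l \<le> n - m" for l
      using saw_coord_bound[OF saw, of m "m + l" i] l m amin[of "m + l"] mlast[of "m + l"] len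
      by (fastforce simp: v_def)+
    ultimately show ?thesis by (simp add: half_space_saws_def)
  qed
  moreover have "w = (let L = rev (map (\<lambda>x. x - axis i 1) (tl u)) @ tl v in map (\<lambda>x. x - hd L) L)"
  proof -
    have "rev (map (\<lambda>x. x - axis i 1) (tl u)) @ tl v = map (\<lambda>x. x - w ! m) (take (Suc m) w @ tl (drop m w))"
      by (simp add: u_def t_def v_def rev_map comp_def e_def map_tl)
    also have "take (Suc m) w @ tl (drop m w) = w" by (simp add: tl_drop drop_Suc[symmetric])
    finally have L: "rev (map (\<lambda>x. x - axis i 1) (tl u)) @ tl v = map (\<lambda>x. x - w ! m) w" .
    have "hd (map (\<lambda>x. x - w ! m) w) = - (w ! m)"
      using w0 len by (simp add: hd_conv_nth hd_map flip: length_0_conv)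
    then show ?thesis unfolding L Let_def by (simp add: comp_def)
  qed
  ultimately show ?thesis using m by blast
qed

lemma card_saws_le_half_space_pairs:
  "card (saws n :: (int ^ 'd::finite) list set)
    \<le> (\<Sum>m\<le>n. card (half_space_saws (i::'d) (Suc n) (Suc m)) * card (half_space_saws i (Suc n) (n - m)))"
proof -
  define glue :: "(int ^ 'd) list \<times> (int ^ 'd) list \<Rightarrow> (int ^ 'd) list" where
    "glue = (\<lambda>(u, v). let L = rev (map (\<lambda>x. x - axis i 1) (tl u)) @ tl v in map (\<lambda>x. x - hd L) L)"
  have "saws n \<subseteq> {} \<union> (\<Union>m\<le>n. glue ` (half_space_saws i (Suc n) (Suc m) \<times> half_space_saws i (Suc n) (n - m)))"
  proof
    fix w :: "(int ^ 'd) list" assume "w \<in> saws n"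
    from split_at_min[OF this, of i] obtain m u v where
      *: "m \<le> n" "u \<in> half_space_saws i (Suc n) (Suc m)" "v \<in> half_space_saws i (Suc n) (n - m)" "w = glue (u, v)"
      unfolding glue_def by auto
    then show "w \<in> {} \<union> (\<Union>m\<le>n. glue ` (half_space_saws i (Suc n) (Suc m) \<times> half_space_saws i (Suc n) (n - m)))"
      by blast
  qed
  from card_le_sum_products[OF this] show ?thesis by simp
qed

section \<open>Generating functions\<close>

lemma sum_convolution_le:
  fixes f g :: "nat \<Rightarrow> real"
  assumes "\<And>k. 0 \<le> f k" "\<And>k. 0 \<le> g k"
  shows "(\<Sum>n\<le>N. \<Sum>k\<le>n. f k * g (n - k)) \<le> (\<Sum>k\<le>N. f k) * (\<Sum>k\<le>N. g k)"
proof -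
  have "(\<Sum>n\<le>N. \<Sum>k\<le>n. f k * g (n - k)) = (\<Sum>(i, j)\<in>{(i, j). i + j \<le> N}. f i * g j)"
    by (rule sum.triangle_reindex_eq[symmetric])
  also have "\<dots> \<le> (\<Sum>(i, j)\<in>{..N} \<times> {..N}. f i * g j)"
    using assms by (intro sum_mono2) auto
  also have "\<dots> = (\<Sum>k\<le>N. f k) * (\<Sum>k\<le>N. g k)"
    by (simp add: sum_product sum.cartesian_product)
  finally show ?thesis .
qed

definition half_gf :: "'d::finite \<Rightarrow> nat \<Rightarrow> nat \<Rightarrow> real \<Rightarrow> real" where
  "half_gf i A N z = (\<Sum>n\<le>N. real (card (half_space_saws i A n)) * z ^ n)"

lemma half_gf_step:
  assumes "0 \<le> z"
  shows "half_gf i (Suc A) N z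
    \<le> (1 + (\<Sum>k\<le>N. real (card (span_bridges i (Suc A) k)) * z ^ k)) * half_gf i A N z"
proof -
  let ?h = "\<lambda>n. real (card (half_space_saws i A n)) * z ^ n"
  let ?b = "\<lambda>k. real (card (span_bridges i (Suc A) k)) * z ^ k"
  have "real (card (half_space_saws i (Suc A) n)) * z ^ n \<le> ?h n + (\<Sum>k\<le>n. ?b k * ?h (n - k))" for n
  proof -
    have "real (card (half_space_saws i (Suc A) n)) \<le> real (card (half_space_saws i A n)) +
     (\<Sum>k\<le>n. real (card (span_bridges i (Suc A) k)) * real (card (half_space_saws i A (n - k))))"
      using card_half_space_saws_step[of i A n, folded of_nat_le_iff[where 'a = real]] by simp
    then have "real (card (half_space_saws i (Suc A) n)) * z ^ n \<le> (real (card (half_space_saws i A n)) +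
     (\<Sum>k\<le>n. real (card (span_bridges i (Suc A) k)) * real (card (half_space_saws i A (n - k))))) * z ^ n"
      using assms by (intro mult_right_mono) auto
    also have "\<dots> = ?h n + (\<Sum>k\<le>n. ?b k * ?h (n - k))"
    proof -
      have "real (card (span_bridges i (Suc A) k)) * real (card (half_space_saws i A (n - k))) * z ^ n
          = ?b k * ?h (n - k)" if "k \<le> n" for k
      proof -
        have "z ^ n = z ^ k * z ^ (n - k)" using that by (simp flip: power_add)
        then show ?thesis by (simp add: mult_ac)
      qed
      then show ?thesis
        unfolding distrib_right sum_distrib_right
        by (intro arg_cong2[where f = "(+)"] sum.cong refl) simp
    qed
    finally show ?thesis .
  qed
  then have "half_gf i (Suc A) N z \<le> (\<Sum>n\<le>N. ?h n + (\<Sum>k\<le>n. ?b k * ?h (n - k)))"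
    unfolding half_gf_def by (intro sum_mono)
  also have "\<dots> \<le> half_gf i A N z + (\<Sum>k\<le>N. ?b k) * half_gf i A N z"
    unfolding sum.distrib half_gf_def using assms by (intro add_left_mono sum_convolution_le) auto
  finally show ?thesis by (simp add: distrib_right)
qed

lemma half_gf_nonneg: "0 \<le> z \<Longrightarrow> 0 \<le> half_gf i A N z"
  unfolding half_gf_def by (intro sum_nonneg) auto

text \<open>
  Apply \<open>1 + x \<le> exp x\<close> to each factor contributed by a span.
\<close>

lemma half_gf_le_exp_span_bridges:
  assumes "0 \<le> z"
  shows "half_gf i A N z \<le> exp (\<Sum>a\<in>{1..A}. \<Sum>k\<le>N. real (card (span_bridges i a k)) * z ^ k)"
proof (induction A)
  case 0
  have "half_gf i 0 N z \<le> (\<Sum>n\<le>N. if n = 0 then 1 else 0)"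
    unfolding half_gf_def
  proof (rule sum_mono)
    fix n show "real (card (half_space_saws i 0 n)) * z ^ n \<le> (if n = 0 then 1 else 0)"
      using card_half_space_saws_0[of i n] by (cases "n = 0") simp_all
  qed
  then show ?case by simp
next
  case (Suc A)
  let ?B = "\<lambda>a. \<Sum>k\<le>N. real (card (span_bridges i a k)) * z ^ k"
  have B: "0 \<le> ?B a" for a using assms by (intro sum_nonneg) auto
  have "half_gf i (Suc A) N z \<le> (1 + ?B (Suc A)) * half_gf i A N z" by (rule half_gf_step[OF assms])
  also have "\<dots> \<le> exp (?B (Suc A)) * exp (\<Sum>a\<in>{1..A}. ?B a)"
    using Suc B[of "Suc A"] half_gf_nonneg[OF assms] by (intro mult_mono) auto
  also have "\<dots> = exp (\<Sum>a\<in>{1..Suc A}. ?B a)"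
    by (simp add: exp_add mult.commute)
  finally show ?case .
qed

lemma half_gf_le_exp_bridges:
  assumes "0 \<le> z"
  shows "half_gf i A N z \<le> exp (\<Sum>k\<in>{1..N}. real (card (bridges i k)) * z ^ k)"
proof -
  have "(\<Sum>a\<in>{1..A}. \<Sum>k\<le>N. real (card (span_bridges i a k)) * z ^ k)
      = (\<Sum>k\<le>N. real (\<Sum>a\<in>{1..A}. card (span_bridges i a k)) * z ^ k)"
    by (subst sum.swap) (simp add: sum_distrib_right)
  also have "\<dots> \<le> (\<Sum>k\<le>N. real (if k = 0 then 0 else card (bridges i k)) * z ^ k)"
    using assms by (intro sum_mono mult_right_mono of_nat_mono sum_span_bridges) simp
  also have "\<dots> = (\<Sum>k\<in>{1..N}. real (card (bridges i k)) * z ^ k)"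
    by (intro sum.mono_neutral_cong_right) auto
  finally show ?thesis
    by (intro order_trans[OF half_gf_le_exp_span_bridges[OF assms]]) simp
qed

text \<open>
  Height and length \<open>n + 1\<close> suffice because the two half-space walks obtained from a walk of length \<open>n\<close>
  have at most \<open>n + 1\<close> steps.
\<close>

lemma saw_count_le_half_gf:
  fixes i :: "'d::finite"
  assumes "0 \<le> z"
  shows "real (saw_count TYPE('d) n) * z ^ (n + 1) \<le> (half_gf i (Suc n) (Suc n) z)\<^sup>2"
proof -
  let ?f = "\<lambda>k. real (card (half_space_saws i (Suc n) k)) * z ^ k"
  have f: "0 \<le> ?f k" for k using assms by simp
  have "real (saw_count TYPE('d) n) \<le>
      (\<Sum>m\<le>n. real (card (half_space_saws i (Suc n) (Suc m))) * real (card (half_space_saws i (Suc n) (n - m))))"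
    using card_saws_le_half_space_pairs[of n i, folded of_nat_le_iff[where 'a = real]] unfolding saw_count_eq by simp
  then have "real (saw_count TYPE('d) n) * z ^ (n + 1) \<le>
      (\<Sum>m\<le>n. real (card (half_space_saws i (Suc n) (Suc m))) * real (card (half_space_saws i (Suc n) (n - m)))) * z ^ (n + 1)"
    using assms by (intro mult_right_mono) auto
  also have "\<dots> = (\<Sum>m\<le>n. ?f (Suc m) * ?f (n - m))"
  proof -
    have "z ^ (n + 1) = z ^ Suc m * z ^ (n - m)" if "m \<le> n" for m
      using that by (simp flip: power_add power_Suc)
    then show ?thesis unfolding sum_distrib_right by (intro sum.cong) (auto simp: mult_ac)
  qed
  also have "\<dots> \<le> (\<Sum>m\<le>n. ?f (Suc m) * half_gf i (Suc n) (Suc n) z)"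
    unfolding half_gf_def using assms by (intro sum_mono mult_left_mono member_le_sum) simp_all
  also have "\<dots> = (\<Sum>m\<le>n. ?f (Suc m)) * half_gf i (Suc n) (Suc n) z"
    by (simp only: sum_distrib_right)
  also have "\<dots> \<le> half_gf i (Suc n) (Suc n) z * half_gf i (Suc n) (Suc n) z"
  proof (rule mult_right_mono)
    show "(\<Sum>m\<le>n. ?f (Suc m)) \<le> half_gf i (Suc n) (Suc n) z"
      unfolding half_gf_def sum.atMost_Suc_shift[of _ n] using f[of 0] by linarith
  qed (rule half_gf_nonneg[OF assms])
  finally show ?thesis by (simp add: power2_eq_square)
qed

text \<open>
  With \<open>z = 1 / (\<mu> (1 + \<delta>))\<close> and \<open>q = \<mu> z = 1 / (1 + \<delta>)\<close>, the partial sums of the bridge series are at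
  most \<open>q + q\<^sup>2 + \<dots> = 1 / \<delta>\<close>. The arbitrary element \<open>undefined\<close> serves as the coordinate direction.
\<close>

lemma saw_count_le:
  assumes d: "0 < \<delta>"
  shows "real (saw_count TYPE('d::finite) n)
    \<le> exp (2 / \<delta>) * (connective_constant TYPE('d) * (1 + \<delta>)) ^ (n + 1)"
proof -
  define \<mu> where "\<mu> = connective_constant TYPE('d)"
  define z where "z = 1 / (\<mu> * (1 + \<delta>))"
  have mu: "0 < \<mu>" unfolding \<mu>_def by (rule connective_constant_pos)
  have z: "0 < z" using mu d by (simp add: z_def)
  define q where "q = \<mu> * z"
  have q: "q = 1 / (1 + \<delta>)" "0 < q" using mu d by (auto simp: q_def z_def)
  have geom: "(\<Sum>k\<in>{1..N}. q ^ k) = (1 - q ^ N) / \<delta>" for N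
  proof (induction N)
    case (Suc N)
    have "q ^ N = q ^ Suc N * (1 + \<delta>)" using q d by simp
    then have "q ^ Suc N = (q ^ N - q ^ Suc N) / \<delta>" using d by (simp add: field_simps)
    then show ?case using Suc by (simp add: diff_divide_distrib)
  qed simp
  have "half_gf (undefined :: 'd) A N z \<le> exp (1 / \<delta>)" for A N
  proof -
    have "(\<Sum>k\<in>{1..N}. real (card (bridges (undefined :: 'd) k)) * z ^ k) \<le> (\<Sum>k\<in>{1..N}. \<mu> ^ k * z ^ k)"
      using z by (intro sum_mono mult_right_mono) (auto simp: \<mu>_def card_bridges_le_connective_power)
    also have "\<dots> = (1 - q ^ N) / \<delta>" using geom[of N] by (simp only: q_def power_mult_distrib)
    also have "\<dots> \<le> 1 / \<delta>" using q(2) d by (intro divide_right_mono) auto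
    finally show ?thesis
      using z by (intro order_trans[OF half_gf_le_exp_bridges]) simp_all
  qed
  then have "(half_gf (undefined :: 'd) (Suc n) (Suc n) z)\<^sup>2 \<le> (exp (1 / \<delta>))\<^sup>2"
    using z by (intro power_mono half_gf_nonneg) auto
  also have "\<dots> = exp (2 / \<delta>)" by (simp flip: exp_double)
  finally have "real (saw_count TYPE('d) n) * z ^ (n + 1) \<le> exp (2 / \<delta>)"
    using saw_count_le_half_gf[of z n "undefined :: 'd"] z by linarith
  then have "real (saw_count TYPE('d) n) \<le> exp (2 / \<delta>) / z ^ (n + 1)"
    using z by (simp add: pos_le_divide_eq)
  also have "\<dots> = exp (2 / \<delta>) * (\<mu> * (1 + \<delta>)) ^ (n + 1)"
    by (simp add: z_def power_one_over)
  finally show ?thesis by (simp add: \<mu>_def)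
qed

theorem proposition2p2:
  assumes "CARD('d::finite) \<ge> 2"
  shows "\<exists>K::real. \<exists>N::nat. N \<ge> 1 \<and>
           (\<forall>n\<ge>N. real (saw_count TYPE('d) n)
              \<le> exp (sqrt (8 * real n) + K * real n powr (- 1 / 2))
                * connective_constant TYPE('d) ^ (n + 1))"
proof (rule exI[of _ "sqrt 2"], rule exI[of _ 1], intro conjI allI impI)
  fix n :: nat assume n: "1 \<le> n"
  define s where "s = sqrt (real n)"
  have s: "0 < s" "s * s = real n" using n by (auto simp: s_def)
  \<comment> \<open>This is the minimiser of \<open>2 / \<delta> + n \<delta>\<close>; both terms then equal \<open>sqrt (2 n)\<close>.\<close>
  define \<delta> where "\<delta> = sqrt 2 / s"
  have d: "0 < \<delta>" using s by (simp add: \<delta>_def)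
  have "real n powr (- 1 / 2) = 1 / s"
    using powr_minus_divide[of "real n" "1/2"] powr_half_sqrt[of "real n"] by (simp add: s_def)
  moreover have "sqrt (8 * real n) = 2 * sqrt 2 * s"
  proof -
    have "sqrt 8 = 2 * sqrt 2" using real_sqrt_mult[of 4 2] by simp
    then show ?thesis by (simp add: real_sqrt_mult s_def)
  qed
  moreover have "2 / \<delta> = sqrt 2 * s"
    using s by (simp add: \<delta>_def field_simps)
  moreover have "real (n + 1) * \<delta> = sqrt 2 * s + sqrt 2 * (1 / s)"
    using s(1) by (simp add: \<delta>_def s(2)[symmetric] field_simps)
  ultimately have e: "2 / \<delta> + real (n + 1) * \<delta> = sqrt (8 * real n) + sqrt 2 * real n powr (- 1 / 2)"
    by simp
  have "(1 + \<delta>) ^ (n + 1) \<le> exp \<delta> ^ (n + 1)"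
    using d by (intro power_mono) auto
  also have "\<dots> = exp (real (n + 1) * \<delta>)" by (rule exp_of_nat_mult[symmetric])
  finally have "exp (2 / \<delta>) * (connective_constant TYPE('d) * (1 + \<delta>)) ^ (n + 1)
     \<le> exp (2 / \<delta>) * (connective_constant TYPE('d) ^ (n + 1) * exp (real (n + 1) * \<delta>))"
    unfolding power_mult_distrib using connective_constant_pos[where 'd = 'd]
    by (intro mult_left_mono) (auto intro: zero_le_power less_imp_le)
  also have "\<dots> = exp (2 / \<delta> + real (n + 1) * \<delta>) * connective_constant TYPE('d) ^ (n + 1)"
    by (simp add: exp_add)
  finally show "real (saw_count TYPE('d) n)
      \<le> exp (sqrt (8 * real n) + sqrt 2 * real n powr (- 1 / 2)) * connective_constant TYPE('d) ^ (n + 1)"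
    using saw_count_le[OF d, where 'd = 'd and n = n] unfolding e by linarith
qed simp

end
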